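(* Let $H$ be a graph that is one of the following: (1) a path $P_k$; (2) a cycle $C_k$; (3) a star $S_k$; (4) a spider graph in $SP_k$ with $k\le 4$. Then $\mu_{\mathrm{int}}(K_1\odot H)\le 2$.
   Context: Graphs are finite and simple. $P_k$ is the path with $k$ vertices; $C_k$ ($k\ge 3$) is the cycle with $k$ vertices; the star $S_k=K_{1,k}$ has a center vertex adjacent to $k$ leaves. A spider graph is a tree with a center vertex of degree at least $3$ and all other vertices of degree at most $2$; $SP_k$ denotes the family of spider graphs whose center has degree exactly $k$. The corona product $K_1\odot H$ is the graph obtained from $H$ by adding a new vertex adjacent to every vertex of $H$. An improper interval coloring of a graph $G$ is an assignment of colors (natural numbers) to the edges of $G$, not necessarily proper, such that for every vertex $v$ the set of colors on the edges incident with $v$ is an integral interval (a set of consecutive integers). It is $k$-improper if at most $k$ edges with the same color all share a common endpoint, i.e. at each vertex each color appears on at most $k$ incident edges. The interval coloring impropriety $\mu_{\mathrm{int}}(G)$ is the smallest positive integer $k$ such that $G$ has a $k$-improper interval coloring. *)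

theory Defs
  imports Main
begin

record 'a graph =
  verts :: "'a set"
  edges :: "'a set set"

definition simple_graph :: "'a graph \<Rightarrow> bool" where
  "simple_graph G \<longleftrightarrow> finite (verts G) \<and> (\<forall>e\<in>edges G. e \<subseteq> verts G \<and> card e = 2)"

definition incident_edges :: "'a graph \<Rightarrow> 'a \<Rightarrow> 'a set set" where
  "incident_edges G v = {e \<in> edges G. v \<in> e}"

definition degree :: "'a graph \<Rightarrow> 'a \<Rightarrow> nat" where
  "degree G v = card (incident_edges G v)"

definition isomorphic :: "'a graph \<Rightarrow> 'b graph \<Rightarrow> bool" where
  "isomorphic G H \<longleftrightarrow>
     (\<exists>f. bij_betw f (verts G) (verts H) \<and> edges H = (\<lambda>e. f ` e) ` edges G)"

definition subgraph :: "'a graph \<Rightarrow> 'a graph \<Rightarrow> bool" where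
  "subgraph G H \<longleftrightarrow> simple_graph G \<and> verts G \<subseteq> verts H \<and> edges G \<subseteq> edges H"

definition path_graph :: "nat \<Rightarrow> nat graph" where
  "path_graph k = \<lparr>verts = {..<k}, edges = {{i, Suc i} |i. Suc i < k}\<rparr>"

definition cycle_graph :: "nat \<Rightarrow> nat graph" where
  "cycle_graph k = \<lparr>verts = {..<k}, edges = {{i, Suc i mod k} |i. i < k}\<rparr>"

definition star_graph :: "nat \<Rightarrow> nat graph" where
  "star_graph k = \<lparr>verts = {0..k}, edges = {{0, i} |i. i \<in> {1..k}}\<rparr>"

definition connected_graph :: "'a graph \<Rightarrow> bool" where
  "connected_graph G \<longleftrightarrow> verts G \<noteq> {} \<and>
     (\<forall>u\<in>verts G. \<forall>v\<in>verts G. (u, v) \<in> {(x, y). {x, y} \<in> edges G}\<^sup>*)"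

definition acyclic_graph :: "'a graph \<Rightarrow> bool" where
  "acyclic_graph G \<longleftrightarrow> \<not> (\<exists>C k. subgraph C G \<and> 3 \<le> k \<and> isomorphic C (cycle_graph k))"

definition tree :: "'a graph \<Rightarrow> bool" where
  "tree G \<longleftrightarrow> simple_graph G \<and> connected_graph G \<and> acyclic_graph G"

definition SP :: "nat \<Rightarrow> 'a graph set" where
  "SP k = {G. tree G \<and> 3 \<le> k \<and>
     (\<exists>c\<in>verts G. degree G c = k \<and> (\<forall>v\<in>verts G - {c}. degree G v \<le> 2))}"

(* The corona product of K_1 with H; None is the added vertex. *)
definition K1_corona :: "'a graph \<Rightarrow> 'a option graph" where
  "K1_corona H = \<lparr>verts = insert None (Some ` verts H),
     edges = (\<lambda>e. Some ` e) ` edges H \<union> {{None, Some v} |v. v \<in> verts H}\<rparr>"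

(* The empty interval occurs exactly at isolated vertices. *)
definition improper_interval_coloring :: "'a graph \<Rightarrow> ('a set \<Rightarrow> nat) \<Rightarrow> bool" where
  "improper_interval_coloring G f \<longleftrightarrow>
     (\<forall>v\<in>verts G. \<exists>a b. f ` incident_edges G v = {a..b})"

definition k_improper :: "nat \<Rightarrow> 'a graph \<Rightarrow> ('a set \<Rightarrow> nat) \<Rightarrow> bool" where
  "k_improper k G f \<longleftrightarrow>
     (\<forall>v\<in>verts G. \<forall>c. card {e \<in> incident_edges G v. f e = c} \<le> k)"

definition interval_impropriety :: "'a graph \<Rightarrow> nat" where
  "interval_impropriety G =
     (LEAST k. 1 \<le> k \<and> (\<exists>f. improper_interval_coloring G f \<and> k_improper k G f))"

(* A constant coloring is always admissible, so LEAST above is never vacuous. *)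
lemma interval_impropriety_exists:
  assumes "simple_graph G"
  shows "\<exists>k\<ge>1. \<exists>f. improper_interval_coloring G f \<and> k_improper k G f"
proof -
  let ?f = "\<lambda>_::'a set. 0::nat"
  have fin: "finite (edges G)"
    using assms unfolding simple_graph_def
    by (meson PowI finite_Pow_iff finite_subset subsetI)
  have "\<exists>a b. ?f ` incident_edges G v = {a..b}" for v
  proof (cases "incident_edges G v = {}")
    case True
    then have "?f ` incident_edges G v = {1..0}" by simp
    then show ?thesis by blast
  next
    case False
    then have "?f ` incident_edges G v = {0..0}" by auto
    then show ?thesis by blast
  qed
  then have "improper_interval_coloring G ?f"
    unfolding improper_interval_coloring_def by blast
  moreover have "k_improper (Suc (card (edges G))) G ?f"
    unfolding k_improper_def incident_edges_def
    by (auto intro!: le_SucI card_mono fin)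
  moreover have "1 \<le> Suc (card (edges G))" by simp
  ultimately show ?thesis by blast
qed

end

theory Submission imports Defs begin

text \<open>
  An edge coloring of \<open>K\<^sub>1 \<odot> H\<close> amounts to a coloring \<open>g\<close> of the vertices of \<open>H\<close> (the color of
  \<open>v\<close> being that of the spoke from the added vertex to \<open>v\<close>) together with a coloring \<open>h\<close> of the
  edges of \<open>H\<close>. At the added vertex, the values of \<open>g\<close> must form an interval and each may be taken
  at most twice; so \<open>g\<close> has to spread the vertices of \<open>H\<close> evenly over about half as many colors.
  At a vertex \<open>v\<close>, the color \<open>g v\<close> and the edges of \<open>H\<close> at \<open>v\<close> must agree with each other, which
  forces \<open>g\<close> to change slowly along the edges. For a vertex of degree two it suffices that the three
  colors at hand are two consecutive ones, both of which occur.

  Each of the four families has a natural arrangement in two parallel rows that does this.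
  A path is cut into consecutive pairs, so \<open>g i = i div 2\<close>, and a star is treated in the same way,
  the edge to a leaf copying the color of its spoke. A cycle is folded flat, and \<open>g\<close> measures the
  height above the bottom of the fold: for odd length the bottom is a single vertex, for even length
  it is an edge. A spider with at most four legs is drawn with at most two legs pointing up and at
  most two pointing down, and \<open>g\<close> is the height, the center being at a height \<open>N\<close> that exceeds the
  length of each leg; an edge has the color of its end further from the center, so that the five
  edges at the center are colored at worst \<open>N - 1\<close>, \<open>N - 1\<close>, \<open>N\<close>, \<open>N + 1\<close>, \<open>N + 1\<close>.

  Paths, cycles and stars are given up to isomorphism, along which such colorings are transported
  (\<open>corona_coloring_isomorphic\<close>). A spider is given only as a tree with a degree condition, and its
  legs have to be found. To this end a largest system of legs issuing from the center is
  chosen (\<open>embedded_spider_maximal\<close>). It covers the graph, since by connectedness an uncovered vertex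
  would be adjacent to a covered one, which would either extend a leg or raise a degree
  beyond its bound; and there are no further edges, since such an edge would close a
  cycle (\<open>embedded_spider_chord_imp_cycle\<close>).
\<close>

section \<open>Colorings of a corona in terms of the base graph\<close>

definition interval_set :: "nat set \<Rightarrow> bool" where
  "interval_set S \<longleftrightarrow> (\<exists>a b. S = {a..b})"

lemma interval_setI:
  assumes "finite S" "\<And>x y z. x \<in> S \<Longrightarrow> y \<in> S \<Longrightarrow> x < z \<Longrightarrow> z < y \<Longrightarrow> z \<in> S"
  shows "interval_set S"
proof (cases "S = {}")
  case True
  then have "S = {1..0}" by simp
  then show ?thesis unfolding interval_set_def by blast
next
  case False
  have "z \<in> S" if "Min S \<le> z" "z \<le> Max S" for z
    using assms(2)[OF Min_in[OF assms(1) False] Max_in[OF assms(1) False], of z]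
      Min_in[OF assms(1) False] Max_in[OF assms(1) False] that
    by (metis le_neq_implies_less)
  then have "S = {Min S..Max S}"
    using Min_le[OF assms(1)] Max_ge[OF assms(1)] by (meson atLeastAtMost_iff equalityI subsetI)
  then show ?thesis unfolding interval_set_def by blast
qed

text \<open>
  The condition at \<open>v\<close> in the corona, where the spoke contributes one further edge, of color \<open>g v\<close>.
\<close>

definition vertex_ok :: "'a graph \<Rightarrow> ('a \<Rightarrow> nat) \<Rightarrow> ('a set \<Rightarrow> nat) \<Rightarrow> 'a \<Rightarrow> bool" where
  "vertex_ok G g h v \<longleftrightarrow>
     interval_set (insert (g v) (h ` incident_edges G v)) \<and>
     (\<forall>c. card {e \<in> incident_edges G v. h e = c} + of_bool (g v = c) \<le> 2)"

definition corona_coloring :: "'a graph \<Rightarrow> ('a \<Rightarrow> nat) \<Rightarrow> ('a set \<Rightarrow> nat) \<Rightarrow> bool" where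
  "corona_coloring G g h \<longleftrightarrow>
     interval_set (g ` verts G) \<and> (\<forall>c. card {v \<in> verts G. g v = c} \<le> 2) \<and>
     (\<forall>v\<in>verts G. vertex_ok G g h v)"

lemma incident_edges_K1_corona_None:
  "incident_edges (K1_corona H) None = (\<lambda>v. {None, Some v}) ` verts H"
  unfolding incident_edges_def K1_corona_def by auto

lemma incident_edges_K1_corona_Some:
  assumes "v \<in> verts H"
  shows "incident_edges (K1_corona H) (Some v) =
    insert {None, Some v} ((`) Some ` incident_edges H v)"
  using assms unfolding incident_edges_def K1_corona_def by auto

lemma impropriety_le_2_if_corona_coloring:
  assumes col: "corona_coloring H g h"
  shows "interval_impropriety (K1_corona H) \<le> 2"
proof -
  \<comment> \<open>An edge through \<open>None\<close> is a spoke and loses its only other end when the option layer is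
    stripped off; every other edge is the image of an edge of \<open>H\<close>.\<close>
  define f where "f e = (if None \<in> e then g (the_elem (Option.these e)) else h (Option.these e))"
    for e :: "'a option set"
  have f_spoke: "f {None, Some v} = g v" for v
  proof -
    have "Option.these {None, Some v} = {v}" by (auto simp: in_these_eq)
    then show ?thesis by (simp add: f_def)
  qed
  have f_edge: "f (Some ` e) = h e" for e
    by (auto simp: f_def these_image_Some_eq)
  have "improper_interval_coloring (K1_corona H) f"
    unfolding improper_interval_coloring_def
  proof
    fix w assume w: "w \<in> verts (K1_corona H)"
    show "\<exists>a b. f ` incident_edges (K1_corona H) w = {a..b}"
    proof (cases w)
      case None
      then have "f ` incident_edges (K1_corona H) w = g ` verts H"
        by (simp add: incident_edges_K1_corona_None image_image f_spoke)
      then show ?thesis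
        using col by (simp add: corona_coloring_def interval_set_def)
    next
      case (Some v)
      then have v: "v \<in> verts H" using w by (auto simp: K1_corona_def)
      then have "f ` incident_edges (K1_corona H) w = insert (g v) (h ` incident_edges H v)"
        by (simp add: Some incident_edges_K1_corona_Some image_image f_spoke f_edge)
      then show ?thesis
        using col v by (simp add: corona_coloring_def vertex_ok_def interval_set_def)
    qed
  qed
  moreover have "k_improper 2 (K1_corona H) f"
    unfolding k_improper_def
  proof (intro ballI allI)
    fix w c assume w: "w \<in> verts (K1_corona H)"
    show "card {e \<in> incident_edges (K1_corona H) w. f e = c} \<le> 2"
    proof (cases w)
      case None
      have "{e \<in> incident_edges (K1_corona H) w. f e = c} =
          (\<lambda>v. {None, Some v}) ` {v \<in> verts H. g v = c}"
        by (auto simp: None incident_edges_K1_corona_None f_spoke)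
      moreover have "inj_on (\<lambda>v. {None, Some v}) {v \<in> verts H. g v = c}"
        by (auto simp: inj_on_def doubleton_eq_iff)
      ultimately show ?thesis
        using col by (simp add: corona_coloring_def card_image)
    next
      case (Some v)
      then have v: "v \<in> verts H" using w by (auto simp: K1_corona_def)
      let ?E = "{e \<in> incident_edges H v. h e = c}"
      have "{e \<in> incident_edges (K1_corona H) w. f e = c} =
          (if g v = c then {{None, Some v}} else {}) \<union> (`) Some ` ?E"
        by (auto simp: Some incident_edges_K1_corona_Some[OF v] f_spoke f_edge)
      also have "card \<dots> \<le> of_bool (g v = c) + card ((`) Some ` ?E)"
        by (rule order_trans[OF card_Un_le]) simp
      also have "card ((`) Some ` ?E) = card ?E"
        by (intro card_image inj_onI) (simp add: inj_image_eq_iff)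
      also have "of_bool (g v = c) + card ?E = card ?E + of_bool (g v = c)" by simp
      also have "\<dots> \<le> 2"
        using col v unfolding corona_coloring_def vertex_ok_def by blast
      finally show ?thesis .
    qed
  qed
  ultimately show ?thesis
    unfolding interval_impropriety_def by (intro Least_le) auto
qed

lemma isomorphic_sym:
  assumes "isomorphic G H" "simple_graph G"
  shows "isomorphic H G"
proof -
  obtain f where f: "bij_betw f (verts G) (verts H)" and E: "edges H = (\<lambda>e. f ` e) ` edges G"
    using assms(1) unfolding isomorphic_def by blast
  let ?g = "the_inv_into (verts G) f"
  have "?g ` f ` e = e" if "e \<in> edges G" for e
  proof -
    have "e \<subseteq> verts G" using that assms(2) by (simp add: simple_graph_def)
    then have "\<forall>x\<in>e. ?g (f x) = x"
      using f by (auto simp: bij_betw_def the_inv_into_f_f)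
    then show ?thesis by (simp add: image_image)
  qed
  then have "edges G = (\<lambda>e. ?g ` e) ` edges H"
    by (simp add: E image_image)
  then show ?thesis
    unfolding isomorphic_def using bij_betw_the_inv_into[OF f] by blast
qed

text \<open>
  Colorings are pulled back along an isomorphism. As \<open>f\<close> is injective on the vertices, its image
  map is injective on edges, so that it preserves the number of edges of each color at a vertex.
\<close>

lemma corona_coloring_isomorphic:
  assumes iso: "isomorphic H G" and simple: "simple_graph H" and col: "corona_coloring G g h"
  obtains g' h' where "corona_coloring H g' h'"
proof -
  obtain f where f: "bij_betw f (verts H) (verts G)" and E: "edges G = (\<lambda>e. f ` e) ` edges H"
    using iso unfolding isomorphic_def by blast
  have inj: "inj_on f (verts H)" and img: "f ` verts H = verts G"
    using f by (auto simp: bij_betw_def)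
  have sub: "e \<subseteq> verts H" if "e \<in> edges H" for e
    using that simple by (simp add: simple_graph_def)
  have inj_img: "inj_on ((`) f) (edges H)"
    using inj sub by (intro inj_onI) (metis inj_on_image_eq_iff)
  have inc: "incident_edges G (f v) = (`) f ` incident_edges H v" if "v \<in> verts H" for v
  proof -
    have "f v \<in> f ` e \<longleftrightarrow> v \<in> e" if "e \<in> edges H" for e
      using inj_on_image_mem_iff[OF inj \<open>v \<in> verts H\<close> sub[OF that]] .
    then show ?thesis unfolding incident_edges_def E by blast
  qed
  have "corona_coloring H (g \<circ> f) (h \<circ> (`) f)"
    unfolding corona_coloring_def
  proof (intro conjI allI ballI)
    show "interval_set ((g \<circ> f) ` verts H)"
      using col by (simp only: image_comp[symmetric] img corona_coloring_def)
  next
    fix c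
    have img_fibre: "f ` {v \<in> verts H. (g \<circ> f) v = c} = {v \<in> verts G. g v = c}"
      by (auto simp: img[symmetric])
    have "inj_on f {v \<in> verts H. (g \<circ> f) v = c}"
      using inj by (rule inj_on_subset) auto
    from card_image[OF this]
    have "card {v \<in> verts H. (g \<circ> f) v = c} = card {v \<in> verts G. g v = c}"
      by (simp only: img_fibre)
    then show "card {v \<in> verts H. (g \<circ> f) v = c} \<le> 2"
      using col by (simp add: corona_coloring_def)
  next
    fix v assume v: "v \<in> verts H"
    then have ok: "vertex_ok G g h (f v)"
      using col img by (auto simp: corona_coloring_def)
    have "card {e \<in> incident_edges H v. (h \<circ> (`) f) e = c} =
        card {e \<in> incident_edges G (f v). h e = c}" for c
    proof -
      have img_fibre: "(`) f ` {e \<in> incident_edges H v. (h \<circ> (`) f) e = c} =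
          {e \<in> incident_edges G (f v). h e = c}"
        by (auto simp: inc[OF v])
      have "inj_on ((`) f) {e \<in> incident_edges H v. (h \<circ> (`) f) e = c}"
        using inj_img by (rule inj_on_subset) (auto simp: incident_edges_def)
      from card_image[OF this] show ?thesis by (simp only: img_fibre)
    qed
    then show "vertex_ok H (g \<circ> f) (h \<circ> (`) f) v"
      using ok by (simp add: vertex_ok_def inc[OF v] image_image)
  qed
  then show ?thesis using that by blast
qed

lemma vertex_ok_no_edge:
  assumes "incident_edges G v = {}"
  shows "vertex_ok G g h v"
proof -
  have "interval_set (insert (g v) (h ` incident_edges G v))"
    by (rule interval_setI) (use assms in auto)
  then show ?thesis using assms by (simp add: vertex_ok_def)
qed

lemma vertex_ok_one_edge:
  assumes "incident_edges G v = {e}" "h e = g v \<or> h e = Suc (g v) \<or> g v = Suc (h e)"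
  shows "vertex_ok G g h v"
proof -
  have "card {e' \<in> incident_edges G v. h e' = c} \<le> 1" for c
    using card_mono[of "{e}" "{e' \<in> incident_edges G v. h e' = c}"] assms(1) by auto
  moreover have "(of_bool (g v = c) :: nat) \<le> 1" for c by simp
  ultimately have "card {e' \<in> incident_edges G v. h e' = c} + of_bool (g v = c) \<le> 1 + 1" for c
    by (rule add_mono)
  moreover have "interval_set (insert (g v) (h ` incident_edges G v))"
    by (rule interval_setI) (use assms in auto)
  ultimately show ?thesis by (simp add: vertex_ok_def numeral_2_eq_2)
qed

text \<open>
  Two consecutive colors form an interval, and if both occur among three edges then neither occurs
  three times. On paths, cycles and spiders, all vertices of degree two are of this kind.
\<close>

lemma vertex_ok_two_edges:
  assumes "incident_edges G v = {e, e'}" "{g v, h e, h e'} = {a, Suc a}"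
  shows "vertex_ok G g h v"
proof -
  have "card {d \<in> incident_edges G v. h d = c} + of_bool (g v = c) \<le> 2" for c
  proof (cases "h e = c \<and> h e' = c")
    case True
    then have "g v \<noteq> c" using assms(2) by auto
    moreover have "card {d \<in> incident_edges G v. h d = c} \<le> card {e, e'}"
      using assms(1) by (intro card_mono) auto
    moreover have "card {e, e'} \<le> 2" by (simp add: card_insert_if)
    ultimately show ?thesis by simp
  next
    case False
    then have "{d \<in> incident_edges G v. h d = c} \<subseteq> {if h e = c then e else e'}"
      using assms(1) by auto
    from card_mono[OF _ this] have "card {d \<in> incident_edges G v. h d = c} \<le> 1" by simp
    moreover have "(of_bool (g v = c) :: nat) \<le> 1" by simp
    ultimately show ?thesis by linarith
  qed
  moreover have "interval_set (insert (g v) (h ` incident_edges G v))"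
    by (rule interval_setI) (use assms in auto)
  ultimately show ?thesis by (simp add: vertex_ok_def)
qed

section \<open>Paths, cycles and stars\<close>

lemma card_div_2_fibre: "card {i \<in> A. i div 2 = (c::nat)} \<le> 2"
proof -
  have "{i \<in> A. i div 2 = c} \<subseteq> {2 * c, Suc (2 * c)}" by auto
  from card_mono[OF _ this] show ?thesis by (simp add: card_insert_if)
qed

text \<open>
  The edge from \<open>i\<close> to \<open>i + 1\<close> is one above the spoke of its first end. Rounding the pairs differently
  for edges and for vertices is what avoids three equal colors at one vertex: at \<open>2 * m\<close> the colors are
  \<open>m\<close> on the edge from below, \<open>m\<close> on the spoke and \<open>m + 1\<close> on the next edge, and at \<open>2 * m + 1\<close> they
  are \<open>m + 1\<close>, \<open>m\<close> and \<open>m + 1\<close>.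
\<close>

lemma path_corona_coloring:
  "corona_coloring (path_graph k) (\<lambda>i. i div 2) (\<lambda>e. Suc (Min e div 2))"
    (is "corona_coloring ?G ?g ?h")
proof -
  have "interval_set (?g ` {..<k})"
  proof (rule interval_setI)
    fix x y z assume "x \<in> ?g ` {..<k}" "y \<in> ?g ` {..<k}" "x < z" "z < y"
    then have "2 * z < k" "z = 2 * z div 2" by auto
    then show "z \<in> ?g ` {..<k}" by blast
  qed simp
  moreover have "vertex_ok ?G ?g ?h i" if "i < k" for i
  proof (cases i)
    case 0
    show ?thesis
    proof (cases "Suc 0 < k")
      case True
      then have "incident_edges ?G i = {{0, Suc 0}}"
        using 0 by (auto simp: incident_edges_def path_graph_def)
      then show ?thesis by (rule vertex_ok_one_edge) (simp add: 0)
    next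
      case False
      then have "incident_edges ?G i = {}"
        by (auto simp: incident_edges_def path_graph_def)
      then show ?thesis by (rule vertex_ok_no_edge)
    qed
  next
    case (Suc j)
    show ?thesis
    proof (cases "Suc i < k")
      case True
      have "incident_edges ?G i = {{j, i}, {i, Suc i}}"
        using True Suc by (auto simp: incident_edges_def path_graph_def)
      moreover have "{i div 2, ?h {j, i}, ?h {i, Suc i}} = {i div 2, Suc (i div 2)}"
      proof (cases "even i")
        case True
        then have "Suc (j div 2) = i div 2" using Suc by presburger
        then show ?thesis by (simp add: Suc)
      next
        case False
        then have "j div 2 = i div 2" using Suc by presburger
        then show ?thesis by (simp add: Suc)
      qed
      ultimately show ?thesis by (rule vertex_ok_two_edges)
    next
      case False
      have "incident_edges ?G i = {{j, i}}"
        using False Suc that by (auto simp: incident_edges_def path_graph_def)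
      moreover have "?h {j, i} = i div 2 \<or> ?h {j, i} = Suc (i div 2)"
        using Suc by simp presburger
      ultimately show ?thesis by (intro vertex_ok_one_edge) auto
    qed
  qed
  ultimately show ?thesis
    by (simp add: corona_coloring_def path_graph_def card_div_2_fibre[of "{..<k}", simplified])
qed

text \<open>
  The center of the star and the added vertex play symmetric roles in the corona: both are joined to
  all leaves and to each other. Giving both edges at a leaf the same color therefore makes the colors
  at the two hubs agree.
\<close>

lemma star_corona_coloring:
  "corona_coloring (star_graph k) (\<lambda>i. i div 2) (\<lambda>e. Max e div 2)"
    (is "corona_coloring ?G ?g ?h")
proof -
  have img: "?g ` {0..k} = {0..k div 2}"
  proof (intro equalityI subsetI)
    fix x assume "x \<in> {0..k div 2}"
    then have "2 * x \<in> {0..k}" "x = 2 * x div 2" by auto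
    then show "x \<in> ?g ` {0..k}" by blast
  qed (auto simp: div_le_mono)
  have "vertex_ok ?G ?g ?h i" if "i \<le> k" for i
  proof (cases "i = 0")
    case True
    have inc: "incident_edges ?G i = (\<lambda>j. {0, j}) ` {1..k}"
      using True by (auto simp: incident_edges_def star_graph_def)
    have "insert (?g i) (?h ` incident_edges ?G i) = ?g ` insert 0 {1..k}"
      unfolding inc by (simp add: True image_image)
    also have "insert 0 {1..k} = {0..k}" by auto
    finally have "interval_set (insert (?g i) (?h ` incident_edges ?G i))"
      using img by (auto simp: interval_set_def)
    moreover have "card {e \<in> incident_edges ?G i. ?h e = c} + of_bool (?g i = c) \<le> 2" for c
    proof -
      have "{e \<in> incident_edges ?G i. ?h e = c} = (\<lambda>j. {0, j}) ` {j \<in> {1..k}. j div 2 = c}"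
        by (auto simp: inc)
      then have "card {e \<in> incident_edges ?G i. ?h e = c} \<le> card {j \<in> {1..k}. j div 2 = c}"
        by (simp add: card_image_le)
      moreover have "card {j \<in> {1..k}. j div 2 = c} + of_bool (?g i = c) \<le> 2"
      proof (cases "c = 0")
        case True
        have "{j \<in> {1..k}. j div 2 = c} \<subseteq> {1}" using True by auto
        from card_mono[OF _ this] have "card {j \<in> {1..k}. j div 2 = c} \<le> 1" by simp
        moreover have "(of_bool (?g i = c) :: nat) \<le> 1" by simp
        ultimately show ?thesis by linarith
      next
        case False
        then show ?thesis using True card_div_2_fibre[of "{1..k}" c] by simp
      qed
      ultimately show ?thesis by linarith
    qed
    ultimately show ?thesis by (simp add: vertex_ok_def)
  next
    case False
    then have "incident_edges ?G i = {{0, i}}"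
      using that by (auto simp: incident_edges_def star_graph_def)
    then show ?thesis by (rule vertex_ok_one_edge) simp
  qed
  then show ?thesis
    using card_div_2_fibre[of "{0..k}"] img
    by (auto simp: corona_coloring_def star_graph_def interval_set_def)
qed

text \<open>
  The predecessor of \<open>i\<close> on the cycle is written without modular arithmetic, as
  \<open>(if i = 0 then n else i) - 1\<close>.
\<close>

lemma incident_edges_cycle_graph:
  assumes "3 \<le> n" "i < n"
  shows "incident_edges (cycle_graph n) i = {{(if i = 0 then n else i) - 1, i}, {i, Suc i mod n}}"
proof (intro equalityI subsetI)
  fix e assume "e \<in> incident_edges (cycle_graph n) i"
  then obtain j where j: "j < n" "e = {j, Suc j mod n}" "i \<in> e"
    by (auto simp: incident_edges_def cycle_graph_def)
  show "e \<in> {{(if i = 0 then n else i) - 1, i}, {i, Suc i mod n}}"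
  proof (cases "i = j")
    case False
    then have "i = Suc j mod n" using j by auto
    then have "j = (if i = 0 then n else i) - 1"
      using j(1) by (cases "Suc j = n") auto
    then show ?thesis using j \<open>i = Suc j mod n\<close> by simp
  qed (use j in simp)
next
  fix e assume "e \<in> {{(if i = 0 then n else i) - 1, i}, {i, Suc i mod n}}"
  moreover define p where "p = (if i = 0 then n else i) - 1"
  moreover have "p < n" "Suc p mod n = i" using assms by (auto simp: p_def)
  ultimately have "\<exists>j<n. e = {j, Suc j mod n}" "i \<in> e" using assms by auto
  then show "e \<in> incident_edges (cycle_graph n) i"
    by (auto simp: incident_edges_def cycle_graph_def)
qed

text \<open>
  Edge colors are described below by the position \<open>i\<close> of the edge between \<open>i\<close> and \<open>Suc i mod n\<close>. The
  position is the smaller end of the edge, except for the closing edge at position \<open>n - 1\<close>.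
\<close>

definition cycle_edge_start :: "nat \<Rightarrow> nat set \<Rightarrow> nat" where
  "cycle_edge_start n e = (if {0, n - 1} \<subseteq> e then n - 1 else Min e)"

lemma cycle_edge_start_eq:
  assumes "3 \<le> n" "i < n"
  shows "cycle_edge_start n {i, Suc i mod n} = i"
  using assms by (cases "Suc i = n") (auto simp: cycle_edge_start_def)

lemma cycle_corona_coloring_by_position:
  fixes n :: nat and g s :: "nat \<Rightarrow> nat"
  assumes n: "3 \<le> n"
    and interval: "interval_set (g ` {..<n})"
    and fibre: "\<And>c. card {i \<in> {..<n}. g i = c} \<le> 2"
    and ok: "\<And>i. i < n \<Longrightarrow>
      \<exists>a. {g i, s ((if i = 0 then n else i) - 1), s i} = {a, Suc a}"
  shows "corona_coloring (cycle_graph n) g (s \<circ> cycle_edge_start n)"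
proof -
  have "vertex_ok (cycle_graph n) g (s \<circ> cycle_edge_start n) i" if i: "i < n" for i
  proof -
    define p where "p = (if i = 0 then n else i) - 1"
    have p: "p < n" "Suc p mod n = i" using n i by (auto simp: p_def)
    have "(s \<circ> cycle_edge_start n) {p, i} = s p"
      using cycle_edge_start_eq[OF n p(1)] p(2) by simp
    moreover have "(s \<circ> cycle_edge_start n) {i, Suc i mod n} = s i"
      using cycle_edge_start_eq[OF n i] by simp
    moreover obtain a where "{g i, s p, s i} = {a, Suc a}"
      using ok[OF i] p_def by auto
    moreover have "incident_edges (cycle_graph n) i = {{p, i}, {i, Suc i mod n}}"
      using incident_edges_cycle_graph[OF n i] by (simp add: p_def)
    ultimately show ?thesis by (metis vertex_ok_two_edges)
  qed
  then show ?thesis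
    using interval fibre by (auto simp: corona_coloring_def cycle_graph_def)
qed

text \<open>
  The cycle is folded in half. For even \<open>n\<close> the heights along the cycle are
  \<open>0, 1, \<dots>, m - 1, m - 1, \<dots>, 1, 0\<close> with \<open>n = 2 * m\<close>, and each height is taken exactly twice. For odd
  \<open>n = 2 * m + 1\<close> they are \<open>0, 1, \<dots>, m, m, \<dots>, 1\<close>, and only the height \<open>0\<close> is taken once. Edges on the two
  flanks have the height of their upper end. An edge across the top is raised one above its two ends,
  for otherwise three equal colors would meet there. The edge across the bottom, which exists for even
  \<open>n\<close>, keeps the color \<open>0\<close> of its ends, since the flank edges there already have color \<open>1\<close>.
  In all cases the colors at \<open>i\<close> are \<open>g i\<close> and \<open>g i + 1\<close>.
\<close>

lemma cycle_corona_coloring: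
  assumes n: "3 \<le> n"
  obtains g h where "corona_coloring (cycle_graph n) g h"
proof (cases "even n")
  case True
  let ?g = "\<lambda>i. min i (n - 1 - i)" and ?s = "\<lambda>i. min (Suc i) (n - 1 - i)"
  have "corona_coloring (cycle_graph n) ?g (?s \<circ> cycle_edge_start n)"
  proof (rule cycle_corona_coloring_by_position[OF n])
    show "interval_set (?g ` {..<n})"
    proof (rule interval_setI)
      fix x y z assume y: "y \<in> ?g ` {..<n}" and "z < y"
      from y obtain i where "i < n" "y = ?g i" by blast
      then have "z < i" "z < n - 1 - i" using \<open>z < y\<close> by simp_all
      then have "z < n" "z \<le> n - 1 - z" by linarith+
      then show "z \<in> ?g ` {..<n}" by (intro image_eqI[of _ _ z]) simp_all
    qed simp
  next
    fix c
    have "{i \<in> {..<n}. ?g i = c} \<subseteq> {c, n - 1 - c}" by auto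
    from card_mono[OF _ this] show "card {i \<in> {..<n}. ?g i = c} \<le> 2"
      by (simp add: card_insert_if split: if_splits)
  next
    fix i assume i: "i < n"
    obtain m where m: "n = 2 * m" using True by blast
    let ?p = "(if i = 0 then n else i) - 1"
    have "{?g i, ?s ?p, ?s i} = {?g i, Suc (?g i)}"
    proof (cases "i < m")
      case True
      then have "?g i = i" "?s i = Suc i" by (simp_all add: m)
      moreover have "?s ?p = i"
      proof (cases i)
        case 0
        then show ?thesis using n by simp
      next
        case (Suc q)
        then have "Suc q \<le> n - 1 - q" using True m by linarith
        then show ?thesis using Suc by simp
      qed
      ultimately show ?thesis by (simp only:) blast
    next
      case False
      then have "?g i = n - 1 - i" "?s i = n - 1 - i" by (simp_all add: m)
      moreover have "?s ?p = Suc (n - 1 - i)" using False i n by (simp add: m)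
      ultimately show ?thesis by (simp only:) blast
    qed
    then show "\<exists>a. {?g i, ?s ((if i = 0 then n else i) - 1), ?s i} = {a, Suc a}"
      by blast
  qed
  then show ?thesis by (rule that)
next
  case False
  let ?g = "\<lambda>i. min i (n - i)" and ?s = "\<lambda>i. Suc (min i (n - 1 - i))"
  have "corona_coloring (cycle_graph n) ?g (?s \<circ> cycle_edge_start n)"
  proof (rule cycle_corona_coloring_by_position[OF n])
    show "interval_set (?g ` {..<n})"
    proof (rule interval_setI)
      fix x y z assume y: "y \<in> ?g ` {..<n}" and "z < y"
      from y obtain i where "i < n" "y = ?g i" by blast
      then have "z < i" "z < n - i" using \<open>z < y\<close> by simp_all
      then have "z < n" "z \<le> n - z" by linarith+
      then show "z \<in> ?g ` {..<n}" by (intro image_eqI[of _ _ z]) simp_all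
    qed simp
  next
    fix c
    have "{i \<in> {..<n}. ?g i = c} \<subseteq> {c, n - c}" by auto
    from card_mono[OF _ this] show "card {i \<in> {..<n}. ?g i = c} \<le> 2"
      by (simp add: card_insert_if split: if_splits)
  next
    fix i assume i: "i < n"
    obtain m where m: "n = Suc (2 * m)" using False by (metis Suc_eq_plus1 oddE)
    let ?p = "(if i = 0 then n else i) - 1"
    have "{?g i, ?s ?p, ?s i} = {?g i, Suc (?g i)}"
    proof (cases "i \<le> m")
      case True
      then have "?g i = i" "?s i = Suc i" by (simp_all add: m)
      moreover have "?s ?p = (if i = 0 then 1 else i)"
      proof (cases i)
        case (Suc q)
        then have "q \<le> n - 1 - q" using True m by linarith
        then show ?thesis using Suc by simp
      qed simp
      ultimately show ?thesis by (simp only:) auto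
    next
      case False
      then have "?g i = n - i" "?s i = n - i" using i by (simp_all add: m)
      moreover have "?s ?p = Suc (n - i)" using False i by (simp add: m)
      ultimately show ?thesis by (simp only:) blast
    qed
    then show "\<exists>a. {?g i, ?s ((if i = 0 then n else i) - 1), ?s i} = {a, Suc a}"
      by blast
  qed
  then show ?thesis by (rule that)
qed

section \<open>Spiders with at most four legs\<close>

text \<open>
  Points of the model are pairs of a leg and a depth. All legs share their point of depth \<open>0\<close>, the
  center, so that walking along a leg from the center needs no case distinction.
\<close>

definition node :: "nat \<Rightarrow> nat \<Rightarrow> nat \<times> nat" where
  "node j i = (if i = 0 then (0, 0) else (j, i))"

definition spider_graph :: "nat \<Rightarrow> (nat \<Rightarrow> nat) \<Rightarrow> (nat \<times> nat) graph" where
  "spider_graph k l =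
     \<lparr>verts = insert (0, 0) {(j, i). j < k \<and> 1 \<le> i \<and> i \<le> l j},
      edges = {{node j i, node j (Suc i)} |j i. j < k \<and> i < l j}\<rparr>"

lemma node_eq_iff: "node j i = node j' i' \<longleftrightarrow> i = i' \<and> (i = 0 \<or> j = j')"
  by (auto simp: node_def)

lemma node_0: "node j 0 = (0, 0)"
  by (simp add: node_def)

lemma verts_spider_graph:
  "verts (spider_graph k l) = insert (0, 0) {node j i |j i. j < k \<and> i \<le> l j}"
proof (intro equalityI subsetI)
  fix x assume "x \<in> verts (spider_graph k l)"
  then consider "x = (0, 0)" | j i where "x = (j, i)" "j < k" "1 \<le> i" "i \<le> l j"
    by (auto simp: spider_graph_def)
  then show "x \<in> insert (0, 0) {node j i |j i. j < k \<and> i \<le> l j}"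
  proof cases
    case 2
    then have "x = node j i" by (simp add: node_def)
    then show ?thesis using 2 by blast
  qed simp
next
  fix x assume "x \<in> insert (0, 0) {node j i |j i. j < k \<and> i \<le> l j}"
  then consider "x = (0, 0)" | j i where "x = node j i" "j < k" "i \<le> l j"
    by blast
  then show "x \<in> verts (spider_graph k l)"
    by cases (simp_all add: spider_graph_def node_def)
qed

lemma edges_spider_graph_iff:
  "e \<in> edges (spider_graph k l) \<longleftrightarrow>
    (\<exists>j i. e = {node j i, node j (Suc i)} \<and> j < k \<and> i < l j)"
  by (simp add: spider_graph_def)

lemma finite_verts_spider_graph: "finite (verts (spider_graph k l))"
proof -
  have "{(j, i). j < k \<and> 1 \<le> i \<and> i \<le> l j} \<subseteq> (SIGMA j:{..<k}. {..l j})" by auto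
  then have "finite {(j, i). j < k \<and> 1 \<le> i \<and> i \<le> l j}"
    by (rule finite_subset) auto
  then show ?thesis by (simp add: spider_graph_def)
qed

lemma simple_spider_graph: "simple_graph (spider_graph k l)"
proof -
  have "e \<subseteq> verts (spider_graph k l) \<and> card e = 2" if e: "e \<in> edges (spider_graph k l)" for e
  proof -
    obtain j i where *: "j < k" "i < l j" "e = {node j i, node j (Suc i)}"
      using e by (auto simp: spider_graph_def)
    have "i \<le> l j" "Suc i \<le> l j" using * by auto
    then have "e \<subseteq> verts (spider_graph k l)"
      using * unfolding verts_spider_graph by blast
    then show ?thesis using * by (simp add: node_eq_iff)
  qed
  then show ?thesis
    by (simp add: simple_graph_def finite_verts_spider_graph)
qed

lemma incident_edges_spider_graph_leg:
  assumes "j < k" "Suc i \<le> l j"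
  shows "incident_edges (spider_graph k l) (node j (Suc i)) =
    insert {node j i, node j (Suc i)}
      (if Suc i < l j then {{node j (Suc i), node j (Suc (Suc i))}} else {})"
    (is "?I = ?R")
proof (intro equalityI subsetI)
  fix e assume "e \<in> ?I"
  then have "node j (Suc i) \<in> e" "e \<in> edges (spider_graph k l)"
    by (simp_all add: incident_edges_def)
  then obtain j' i' where e: "i' < l j'" "e = {node j' i', node j' (Suc i')}"
    unfolding edges_spider_graph_iff by blast
  then have "node j (Suc i) = node j' i' \<or> node j (Suc i) = node j' (Suc i')"
    using \<open>node j (Suc i) \<in> e\<close> by blast
  then have "Suc i = i' \<and> j = j' \<or> i = i' \<and> j = j'"
    by (auto simp: node_eq_iff)
  then show "e \<in> ?R"
    using e by auto
next
  fix e assume "e \<in> ?R"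
  then have "e = {node j i, node j (Suc i)} \<and> i < l j \<or>
      e = {node j (Suc i), node j (Suc (Suc i))} \<and> Suc i < l j"
    using assms by (cases "Suc i < l j") auto
  then obtain i' where i': "i' < l j" "e = {node j i', node j (Suc i')}" and "node j (Suc i) \<in> e"
    by blast
  then have "e \<in> edges (spider_graph k l)"
    using assms(1) unfolding edges_spider_graph_iff by blast
  then show "e \<in> ?I"
    using \<open>node j (Suc i) \<in> e\<close> by (simp add: incident_edges_def)
qed

lemma incident_edges_spider_graph_center:
  "incident_edges (spider_graph k l) (0, 0) = (\<lambda>j. {(0, 0), node j (Suc 0)}) ` {j. j < k \<and> 0 < l j}"
  unfolding incident_edges_def spider_graph_def
  by (auto simp: node_def)

text \<open>
  Even legs point up and odd legs point down, so that with at most four legs at most two share a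
  direction. This is the only place where the bound on the number of legs enters: it limits
  both the number of vertices at a given height and the number of edges of each color at the center.
\<close>

lemma spider_corona_coloring:
  assumes k: "k \<le> 4"
  obtains g h where "corona_coloring (spider_graph k l) g h"
proof -
  let ?G = "spider_graph k l"
  \<comment> \<open>The height of the center, large enough for the legs pointing down to stay above \<open>0\<close>.\<close>
  define N where "N = Suc (\<Sum>j<k. l j)"
  have N: "l j < N" if "j < k" for j
    using that member_le_sum[of j "{..<k}" l] by (simp add: N_def)
  define g where "g v = (if even (fst v) then N + snd v else N - snd v)" for v :: "nat \<times> nat"
  \<comment> \<open>The color of the end further from height \<open>N\<close>.\<close>
  define h where "h e = (if \<exists>v\<in>e. N < g v then Max (g ` e) else Min (g ` e))" for e
  have g_node: "g (node j i) = (if even j then N + i else N - i)" for j i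
    by (simp add: g_def node_def)
  have h_edge: "h {node j i, node j (Suc i)} = g (node j (Suc i))" for j i
    by (auto simp: h_def g_node)
  have small: "card A \<le> 2" if "A \<subseteq> {x, y}" for A and x y :: 'b
    using card_mono[OF _ that] by (simp add: card_insert_if split: if_splits)
  have legs: "j \<in> {0, 1, 2, 3}" if "j < k" for j
    using that k by auto
  have in_img: "g (node j i) \<in> g ` verts ?G" if "j < k" "i \<le> l j" for j i
    using that unfolding verts_spider_graph by blast
  have "interval_set (g ` verts ?G)"
  proof (rule interval_setI)
    show "finite (g ` verts ?G)" by (simp add: finite_verts_spider_graph)
  next
    fix x y z assume x: "x \<in> g ` verts ?G" and y: "y \<in> g ` verts ?G" and z: "x < z" "z < y"
    consider "z = N" | "N < z" | "z < N" by linarith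
    then show "z \<in> g ` verts ?G"
    proof cases
      case 1
      then have "z = g (0, 0)" by (simp add: g_def)
      then show ?thesis by (simp add: verts_spider_graph)
    next
      case 2
      then obtain j i where ji: "j < k" "i \<le> l j" "y = g (node j i)"
        using y z by (auto simp: verts_spider_graph g_def)
      then have "even j" "z - N \<le> l j" "z = g (node j (z - N))"
        using 2 z by (auto simp: g_node split: if_splits)
      then show ?thesis using in_img[OF ji(1)] by metis
    next
      case 3
      then obtain j i where ji: "j < k" "i \<le> l j" "x = g (node j i)"
        using x z by (auto simp: verts_spider_graph g_def)
      then have "odd j" "N - z \<le> l j" "z = g (node j (N - z))"
        using 3 z N[OF ji(1)] by (auto simp: g_node split: if_splits)
      then show ?thesis using in_img[OF ji(1)] by metis
    qed
  qed
  moreover have "card {v \<in> verts ?G. g v = c} \<le> 2" for c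
  proof (cases "c < N")
    case True
    have "{v \<in> verts ?G. g v = c} \<subseteq> {(1, N - c), (3, N - c)}"
    proof
      fix v assume v: "v \<in> {v \<in> verts ?G. g v = c}"
      then have "v \<noteq> (0, 0)" using True by (auto simp: g_def)
      then obtain j i where ji: "v = (j, i)" "j < k" "i \<le> l j"
        using v by (auto simp: spider_graph_def)
      then show "v \<in> {(1, N - c), (3, N - c)}"
        using legs[of j] N[of j] v True by (auto simp: g_def)
    qed
    then show ?thesis by (rule small)
  next
    case False
    have "{v \<in> verts ?G. g v = c} \<subseteq> {(0, c - N), (2, c - N)}"
    proof
      fix v assume v: "v \<in> {v \<in> verts ?G. g v = c}"
      show "v \<in> {(0, c - N), (2, c - N)}"
      proof (cases "v = (0, 0)")
        case True
        then show ?thesis using v by (auto simp: g_def)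
      next
        case nz: False
        then obtain j i where ji: "v = (j, i)" "j < k" "1 \<le> i" "i \<le> l j"
          using v by (auto simp: spider_graph_def)
        then show ?thesis
          using legs[of j] N[of j] v False by (auto simp: g_def)
      qed
    qed
    then show ?thesis by (rule small)
  qed
  moreover have "vertex_ok ?G g h v" if v: "v \<in> verts ?G" for v
  proof (cases "v = (0, 0)")
    case True
    let ?J = "{j. j < k \<and> 0 < l j}"
    have inc: "incident_edges ?G v = (\<lambda>j. {(0, 0), node j (Suc 0)}) ` ?J"
      by (simp add: True incident_edges_spider_graph_center)
    have h_spoke: "h {(0, 0), node j (Suc 0)} = (if even j then Suc N else N - 1)" for j
      using h_edge[of j 0] by (simp add: node_0 g_node)
    have "0 < N" by (simp add: N_def)
    have gv: "g v = N" by (simp add: True g_def)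
    have "interval_set (insert (g v) (h ` incident_edges ?G v))"
    proof (rule interval_setI)
      show "finite (insert (g v) (h ` incident_edges ?G v))" by (simp add: inc)
    next
      fix x y z
      assume "x \<in> insert (g v) (h ` incident_edges ?G v)"
        "y \<in> insert (g v) (h ` incident_edges ?G v)" "x < z" "z < y"
      moreover have "insert (g v) (h ` incident_edges ?G v) \<subseteq> {N - 1, N, Suc N}"
        unfolding inc by (auto simp: gv h_spoke)
      ultimately have "x \<in> {N - 1, N, Suc N}" "y \<in> {N - 1, N, Suc N}" "x < z" "z < y"
        by blast+
      then have "z = N" by auto
      then show "z \<in> insert (g v) (h ` incident_edges ?G v)" by (simp add: gv)
    qed
    moreover have "card {e \<in> incident_edges ?G v. h e = c} + of_bool (g v = c) \<le> 2" for c
    proof (cases "c = N")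
      case True
      then have "{e \<in> incident_edges ?G v. h e = c} = {}"
        using \<open>0 < N\<close> by (auto simp: inc h_spoke split: if_splits)
      then show ?thesis by (simp only: card.empty) simp
    next
      case False
      \<comment> \<open>The parity of the legs that start in the direction of the color \<open>c\<close>.\<close>
      define p :: nat where "p = (if c = Suc N then 0 else 1)"
      have "{e \<in> incident_edges ?G v. h e = c} \<subseteq>
          {{(0, 0), node p (Suc 0)}, {(0, 0), node (p + 2) (Suc 0)}}"
      proof
        fix e assume e: "e \<in> {e \<in> incident_edges ?G v. h e = c}"
        then obtain j where j: "j < k" "e = {(0, 0), node j (Suc 0)}" by (auto simp: inc)
        then have "j \<in> {p, p + 2}"
          using e legs[of j] h_spoke[of j] \<open>0 < N\<close> by (auto simp: p_def split: if_splits)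
        then show "e \<in> {{(0, 0), node p (Suc 0)}, {(0, 0), node (p + 2) (Suc 0)}}"
          using j by auto
      qed
      from small[OF this] show ?thesis using False gv by simp
    qed
    ultimately show ?thesis by (simp add: vertex_ok_def)
  next
    case False
    then obtain j i' where v_eq: "v = (j, i')" and "j < k" "1 \<le> i'" "i' \<le> l j"
      using v by (auto simp: spider_graph_def)
    moreover obtain i where "i' = Suc i"
      using \<open>1 \<le> i'\<close> by (cases i') auto
    ultimately have ji: "v = node j (Suc i)" "j < k" "Suc i \<le> l j"
      by (simp_all add: node_def)
    note inc = incident_edges_spider_graph_leg[of j k i l, OF ji(2,3)]
    show ?thesis
    proof (cases "Suc i < l j")
      case True
      \<comment> \<open>The spoke agrees with the edge towards the center, and the outer edge is one step
        further; on a leg pointing down that step decreases the color.\<close>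
      let ?a = "if even j then N + Suc i else N - Suc (Suc i)"
      have "incident_edges ?G v =
          {{node j i, node j (Suc i)}, {node j (Suc i), node j (Suc (Suc i))}}"
        using inc True by (simp add: ji(1))
      moreover have "{g v, h {node j i, node j (Suc i)}, h {node j (Suc i), node j (Suc (Suc i))}}
          = {?a, Suc ?a}"
        using True N[OF ji(2)] by (auto simp: h_edge ji(1) g_node)
      ultimately show ?thesis by (rule vertex_ok_two_edges)
    next
      case False
      then have "incident_edges ?G v = {{node j i, node j (Suc i)}}"
        using inc by (simp add: ji(1))
      then show ?thesis by (rule vertex_ok_one_edge) (simp add: h_edge ji(1))
    qed
  qed
  ultimately have "corona_coloring ?G g h" by (simp add: corona_coloring_def)
  then show ?thesis by (rule that)
qed

section \<open>Recognizing spiders\<close>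

lemma not_acyclic_if_cyclic_sequence:
  assumes simple: "simple_graph G" and n: "3 \<le> n" and inj: "inj_on f {..<n}"
    and adj: "\<And>i. i < n \<Longrightarrow> {f i, f (Suc i mod n)} \<in> edges G"
  shows "\<not> acyclic_graph G"
proof -
  let ?C = "\<lparr>verts = f ` {..<n}, edges = (\<lambda>e. f ` e) ` edges (cycle_graph n)\<rparr>"
  have "i \<noteq> Suc i mod n" if "i < n" for i
    using that n by (cases "Suc i = n") auto
  then have "simple_graph (cycle_graph n)"
    using n by (auto simp: simple_graph_def cycle_graph_def)
  moreover have "isomorphic (cycle_graph n) ?C"
    unfolding isomorphic_def using inj
    by (intro exI[of _ f]) (auto simp: bij_betw_def cycle_graph_def)
  ultimately have iso: "isomorphic ?C (cycle_graph n)"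
    using isomorphic_sym by blast
  have sub: "edges ?C \<subseteq> edges G"
    using adj by (auto simp: cycle_graph_def)
  have "f i \<in> verts G" if "i < n" for i
    using adj[OF that] simple by (auto simp: simple_graph_def)
  moreover have "e \<subseteq> verts ?C" if "e \<in> edges ?C" for e
    using that by (auto simp: cycle_graph_def)
  ultimately have "subgraph ?C G"
    using sub simple by (auto simp: subgraph_def simple_graph_def)
  then show ?thesis
    using iso n unfolding acyclic_graph_def by blast
qed

text \<open>
  A copy of a model spider inside \<open>G\<close>, as a subgraph that need not be induced.
\<close>

definition embedded_spider ::
    "nat \<Rightarrow> (nat \<Rightarrow> nat) \<Rightarrow> (nat \<times> nat \<Rightarrow> 'a) \<Rightarrow> 'a graph \<Rightarrow> bool" where
  "embedded_spider k l \<phi> G \<longleftrightarrow>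
     inj_on \<phi> (verts (spider_graph k l)) \<and> \<phi> ` verts (spider_graph k l) \<subseteq> verts G \<and>
     (\<forall>j<k. \<forall>i<l j. {\<phi> (node j i), \<phi> (node j (Suc i))} \<in> edges G)"

lemma verts_spider_graph_extend:
  assumes "j < k"
  shows "verts (spider_graph k (l(j := Suc (l j)))) =
    insert (node j (Suc (l j))) (verts (spider_graph k l))"
  using assms by (auto simp: spider_graph_def node_def split: if_splits)

lemma node_Suc_notin_spider_graph: "node j (Suc (l j)) \<notin> verts (spider_graph k l)"
  by (auto simp: spider_graph_def node_def)

lemma embedded_spider_extend:
  assumes emb: "embedded_spider k l \<phi> G" and j: "j < k"
    and y: "y \<in> verts G" "y \<notin> \<phi> ` verts (spider_graph k l)"
    and edge: "{\<phi> (node j (l j)), y} \<in> edges G"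
  shows "embedded_spider k (l(j := Suc (l j))) (\<phi>(node j (Suc (l j)) := y)) G"
proof -
  let ?new = "node j (Suc (l j))" and ?V = "verts (spider_graph k l)"
  have new: "?new \<notin> ?V" by (rule node_Suc_notin_spider_graph)
  have inj: "inj_on \<phi> ?V" and img: "\<phi> ` ?V \<subseteq> verts G"
    and adj: "\<And>j i. j < k \<Longrightarrow> i < l j \<Longrightarrow> {\<phi> (node j i), \<phi> (node j (Suc i))} \<in> edges G"
    using emb by (auto simp: embedded_spider_def)
  have old: "(\<phi>(?new := y)) ` ?V = \<phi> ` ?V"
    using new by (intro image_cong) auto
  have "inj_on (\<phi>(?new := y)) ?V"
    using inj new by (subst inj_on_cong[of _ _ \<phi>]) auto
  then have "inj_on (\<phi>(?new := y)) (insert ?new ?V)"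
    using new y(2) old by simp
  moreover have "(\<phi>(?new := y)) ` insert ?new ?V \<subseteq> verts G"
    using y(1) img unfolding image_insert old by simp
  moreover have "{(\<phi>(?new := y)) (node a i), (\<phi>(?new := y)) (node a (Suc i))} \<in> edges G"
    if "a < k" "i < (l(j := Suc (l j))) a" for a i
    using that adj[of a i] edge
    by (cases "a = j"; cases "i = l j") (auto simp: node_eq_iff)
  ultimately show ?thesis
    by (simp add: embedded_spider_def verts_spider_graph_extend[OF j])
qed

text \<open>
  An embedding with the largest number of vertices cannot be extended at the tip of a leg. A leg of
  length \<open>0\<close> has its tip at the center, so this also says that no new leg can be started while one
  of the \<open>k\<close> legs is still empty.
\<close>

lemma embedded_spider_maximal:
  assumes "finite (verts G)" "c \<in> verts G"
  obtains l \<phi> where "embedded_spider k l \<phi> G" "\<phi> (0, 0) = c"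
    "\<And>j y. j < k \<Longrightarrow> {\<phi> (node j (l j)), y} \<in> edges G \<Longrightarrow> y \<in> verts G \<Longrightarrow>
      y \<in> \<phi> ` verts (spider_graph k l)"
proof -
  let ?P = "\<lambda>(l, \<phi>). embedded_spider k l \<phi> G \<and> \<phi> (0, 0) = c"
  let ?size = "\<lambda>(l, \<phi> :: nat \<times> nat \<Rightarrow> 'a). card (verts (spider_graph k l))"
  have start: "?P (\<lambda>_. 0, \<lambda>_. c)"
    using assms(2) by (auto simp: embedded_spider_def spider_graph_def inj_on_def)
  have bound: "\<forall>s. ?P s \<longrightarrow> ?size s < Suc (card (verts G))"
    using assms(1) by (auto simp: embedded_spider_def less_Suc_eq_le intro!: card_inj_on_le)
  obtain s where "?P s" and max: "\<And>t. ?P t \<Longrightarrow> ?size t \<le> ?size s"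
    using ex_has_greatest_nat[of ?P, OF start bound] by blast
  moreover obtain l \<phi> where s: "s = (l, \<phi>)" by (cases s)
  ultimately have emb: "embedded_spider k l \<phi> G" and c: "\<phi> (0, 0) = c" by auto
  have "y \<in> \<phi> ` verts (spider_graph k l)"
    if "j < k" "{\<phi> (node j (l j)), y} \<in> edges G" "y \<in> verts G" for j y
  proof (rule ccontr)
    assume "y \<notin> \<phi> ` verts (spider_graph k l)"
    then have "embedded_spider k (l(j := Suc (l j))) (\<phi>(node j (Suc (l j)) := y)) G"
      using embedded_spider_extend[OF emb] that by blast
    moreover have "(\<phi>(node j (Suc (l j)) := y)) (0, 0) = c"
      using c by (simp add: node_def)
    ultimately have "card (verts (spider_graph k (l(j := Suc (l j))))) \<le>
        card (verts (spider_graph k l))"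
      using max[of "(l(j := Suc (l j)), \<phi>(node j (Suc (l j)) := y))"] s by simp
    then show False
      by (simp add: verts_spider_graph_extend[OF that(1)] node_Suc_notin_spider_graph
          finite_verts_spider_graph)
  qed
  then show ?thesis using that emb c by blast
qed

lemma finite_edges_simple_graph:
  assumes "simple_graph G"
  shows "finite (edges G)"
proof -
  have "edges G \<subseteq> Pow (verts G)" using assms by (auto simp: simple_graph_def)
  then show ?thesis
    using assms by (auto simp: simple_graph_def intro: finite_subset)
qed

text \<open>
  The cycle runs from one end of the chord down its leg to the center, then up the leg of the other
  end, and back along the chord. If \<open>i' = 0\<close>, the second leg is not entered at all, and \<open>j'\<close> is
  arbitrary.
\<close>

lemma embedded_spider_chord_imp_cycle:
  assumes simple: "simple_graph G" and emb: "embedded_spider k l \<phi> G"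
    and ji: "j < k" "i \<le> l j" "0 < i" and ji': "j' < k" "i' \<le> l j'"
    and sep: "j \<noteq> j' \<or> i' = 0" and len: "2 \<le> i + i'"
    and chord: "{\<phi> (node j i), \<phi> (node j' i')} \<in> edges G"
  shows "\<not> acyclic_graph G"
proof -
  let ?V = "verts (spider_graph k l)"
  have inj: "inj_on \<phi> ?V"
    and adj: "\<And>j i. j < k \<Longrightarrow> i < l j \<Longrightarrow> {\<phi> (node j i), \<phi> (node j (Suc i))} \<in> edges G"
    using emb by (auto simp: embedded_spider_def)
  define w where "w t = (if t < i then node j (i - t) else node j' (t - i))" for t
  define n where "n = Suc (i + i')"
  have "w t \<in> ?V" if "t < n" for t
  proof -
    have "i - t \<le> l j" "t - i \<le> l j'" using that ji ji' by (auto simp: n_def)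
    then show ?thesis
      using ji(1) ji'(1) unfolding w_def verts_spider_graph by auto
  qed
  moreover have "inj_on w {..<n}"
  proof (rule inj_onI)
    fix s t assume "s \<in> {..<n}" "t \<in> {..<n}" "w s = w t"
    then show "s = t"
      using sep by (auto simp: w_def n_def node_eq_iff split: if_splits)
  qed
  ultimately have inj_\<phi>w: "inj_on (\<phi> \<circ> w) {..<n}"
    using inj by (intro comp_inj_on) (auto intro: inj_on_subset)
  have adj_\<phi>w: "{(\<phi> \<circ> w) t, (\<phi> \<circ> w) (Suc t mod n)} \<in> edges G" if t: "t < n" for t
  proof -
    consider "t < i" | "i \<le> t" "Suc t < n" | "Suc t = n" using t by linarith
    then show ?thesis
    proof cases
      case 1
      then have "w (Suc t) = node j (i - Suc t)" "i - t = Suc (i - Suc t)"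
        by (auto simp: w_def node_def)
      then show ?thesis
        using 1 adj[OF ji(1), of "i - Suc t"] ji(2) by (simp add: n_def w_def insert_commute)
    next
      case 2
      then show ?thesis
        using adj[OF ji'(1), of "t - i"] ji'(2) by (simp add: n_def w_def Suc_diff_le)
    next
      case 3
      then show ?thesis
        using chord ji(3) by (simp add: n_def w_def insert_commute)
    qed
  qed
  have "3 \<le> n" using len by (simp add: n_def)
  then show ?thesis
    using not_acyclic_if_cyclic_sequence[OF simple _ inj_\<phi>w] adj_\<phi>w by blast
qed

lemma rtrancl_crossing:
  assumes "(x, y) \<in> R\<^sup>*" "x \<in> S" "y \<notin> S"
  obtains u v where "(u, v) \<in> R" "u \<in> S" "v \<notin> S"
proof -
  have "y \<in> S \<or> (\<exists>u v. (u, v) \<in> R \<and> u \<in> S \<and> v \<notin> S)"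
    using assms(1) by (induction rule: rtrancl_induct) (use assms(2) in blast)+
  then show ?thesis using assms(3) that by blast
qed

text \<open>
  The degree bounds are used in two ways. A vertex strictly inside a leg already has two edges on its
  leg and hence no others (\<open>inner\<close>). The center can have a neighbor outside the embedding only if some
  leg is still empty, and then the embedding was not maximal.
\<close>

lemma spider_isomorphic_spider_graph:
  assumes "G \<in> SP k"
  obtains l where "isomorphic G (spider_graph k l)"
proof -
  obtain c where simple: "simple_graph G" and conn: "connected_graph G" and acyc: "acyclic_graph G"
    and k: "3 \<le> k" and c: "c \<in> verts G" "degree G c = k"
    and deg: "\<And>v. v \<in> verts G \<Longrightarrow> v \<noteq> c \<Longrightarrow> degree G v \<le> 2"
    using assms by (auto simp: SP_def tree_def)
  have finV: "finite (verts G)" using simple by (simp add: simple_graph_def)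
  obtain l \<phi> where emb: "embedded_spider k l \<phi> G" and c_eq: "\<phi> (0, 0) = c"
    and max: "\<And>j y. j < k \<Longrightarrow> {\<phi> (node j (l j)), y} \<in> edges G \<Longrightarrow> y \<in> verts G \<Longrightarrow>
      y \<in> \<phi> ` verts (spider_graph k l)"
    using embedded_spider_maximal[OF finV c(1)] by blast
  let ?V = "verts (spider_graph k l)"
  have inj: "inj_on \<phi> ?V" and img: "\<phi> ` ?V \<subseteq> verts G"
    and adj: "\<And>j i. j < k \<Longrightarrow> i < l j \<Longrightarrow> {\<phi> (node j i), \<phi> (node j (Suc i))} \<in> edges G"
    using emb by (auto simp: embedded_spider_def)
  have V: "node j i \<in> ?V" if "j < k" "i \<le> l j" for j i
    using that unfolding verts_spider_graph by blast
  have V_cases: "\<exists>j i. j < k \<and> i \<le> l j \<and> x = node j i" if "x \<in> ?V" for x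
  proof (cases "x = (0, 0)")
    case True
    then have "0 < k" "0 \<le> l 0" "x = node 0 0" using k by (simp_all add: node_0)
    then show ?thesis by blast
  next
    case False
    then show ?thesis using that unfolding verts_spider_graph by blast
  qed
  have \<phi>_eq: "\<phi> (node j i) = \<phi> (node j' i') \<longleftrightarrow> i = i' \<and> (i = 0 \<or> j = j')"
    if "j < k" "i \<le> l j" "j' < k" "i' \<le> l j'" for j i j' i'
    using inj_on_eq_iff[OF inj V[OF that(1,2)] V[OF that(3,4)]] by (simp add: node_eq_iff)
  have fin_inc: "finite (incident_edges G v)" for v
    using finite_edges_simple_graph[OF simple] by (simp add: incident_edges_def)
  have inner: "e = {\<phi> (node j i), \<phi> (node j (Suc i))} \<or>
      e = {\<phi> (node j (Suc i)), \<phi> (node j (Suc (Suc i)))}"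
    if "j < k" "Suc i < l j" "e \<in> edges G" "\<phi> (node j (Suc i)) \<in> e" for j i e
  proof -
    let ?A = "{{\<phi> (node j i), \<phi> (node j (Suc i))}, {\<phi> (node j (Suc i)), \<phi> (node j (Suc (Suc i)))}}"
    let ?I = "incident_edges G (\<phi> (node j (Suc i)))"
    have sub: "?A \<subseteq> ?I"
      using adj[of j i] adj[of j "Suc i"] that by (auto simp: incident_edges_def)
    have "\<phi> (node j i) \<noteq> \<phi> (node j (Suc (Suc i)))"
      using that by (simp add: \<phi>_eq)
    then have "card ?A = 2" by (auto simp: card_insert_if doubleton_eq_iff)
    moreover have "\<phi> (node j (Suc i)) \<noteq> c"
      using that \<phi>_eq[of j "Suc i" j 0] by (simp add: c_eq[symmetric] node_0)
    then have "card ?I \<le> 2"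
      using deg img V[of j "Suc i"] that by (auto simp: degree_def)
    ultimately have "?A = ?I"
      using card_seteq[OF fin_inc sub] by simp
    moreover have "e \<in> ?I" using that by (simp add: incident_edges_def)
    ultimately show ?thesis by blast
  qed
  have spanning: "\<phi> ` ?V = verts G"
  proof (rule ccontr)
    assume "\<phi> ` ?V \<noteq> verts G"
    then obtain y0 where y0: "y0 \<in> verts G" "y0 \<notin> \<phi> ` ?V" using img by blast
    have "c \<in> \<phi> ` ?V" using c_eq by (auto simp: verts_spider_graph)
    moreover have "(c, y0) \<in> {(x, y). {x, y} \<in> edges G}\<^sup>*"
      using conn c(1) y0(1) by (auto simp: connected_graph_def)
    ultimately obtain x y where xy: "{x, y} \<in> edges G" "x \<in> \<phi> ` ?V" "y \<notin> \<phi> ` ?V"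
      using rtrancl_crossing[of c y0] y0(2) by (metis (no_types, lifting) case_prodD mem_Collect_eq)
    have y: "y \<in> verts G" using xy(1) simple by (auto simp: simple_graph_def)
    obtain j i where ji: "j < k" "i \<le> l j" "x = \<phi> (node j i)"
      using xy(2) V_cases by blast
    have "i \<noteq> l j" using max[OF ji(1) _ y] xy ji by auto
    then have less: "i < l j" using ji by simp
    show False
    proof (cases i)
      case (Suc i0)
      have "y \<in> {\<phi> (node j i0), \<phi> (node j (Suc i0)), \<phi> (node j (Suc (Suc i0)))}"
        using inner[of j i0 "{x, y}"] ji less xy(1) by (auto simp: Suc doubleton_eq_iff)
      moreover have "node j i0 \<in> ?V" "node j (Suc i0) \<in> ?V" "node j (Suc (Suc i0)) \<in> ?V"
        using ji less V by (auto simp: Suc)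
      ultimately show False using xy(3) by blast
    next
      case 0
      then have x: "x = c" using ji c_eq by (simp add: node_0)
      have pos: "0 < l a" if "a < k" for a
      proof (rule ccontr)
        assume "\<not> 0 < l a"
        then have "\<phi> (node a (l a)) = x" using x c_eq by (simp add: node_0)
        then show False using max[OF that _ y] xy by auto
      qed
      let ?A = "(\<lambda>a. {c, \<phi> (node a (Suc 0))}) ` {..<k}"
      have "inj_on (\<lambda>a. {c, \<phi> (node a (Suc 0))}) {..<k}"
      proof (rule inj_onI)
        fix a b assume ab: "a \<in> {..<k}" "b \<in> {..<k}"
          and eq: "{c, \<phi> (node a (Suc 0))} = {c, \<phi> (node b (Suc 0))}"
        have "Suc 0 \<le> l a" "Suc 0 \<le> l b" using ab pos[of a] pos[of b] by auto
        moreover from eq have "\<phi> (node a (Suc 0)) = \<phi> (node b (Suc 0))"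
          by (auto simp: doubleton_eq_iff)
        ultimately show "a = b" using ab \<phi>_eq[of a "Suc 0" b "Suc 0"] by simp
      qed
      then have "card ?A = k" by (simp add: card_image)
      moreover have "{c, y} \<notin> ?A"
      proof
        assume "{c, y} \<in> ?A"
        then obtain a where "a < k" "{c, y} = {c, \<phi> (node a (Suc 0))}" by auto
        then have "a < k" "y = \<phi> (node a (Suc 0)) \<or> y = c" by (auto simp: doubleton_eq_iff)
        moreover have "c \<in> \<phi> ` ?V" by fact
        ultimately show False using xy(3) V[of a "Suc 0"] pos[of a] by auto
      qed
      ultimately have "card (insert {c, y} ?A) = Suc k" by simp
      moreover have "insert {c, y} ?A \<subseteq> incident_edges G c"
      proof -
        have "{c, \<phi> (node a (Suc 0))} \<in> edges G" if "a < k" for a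
          using adj[OF that, of 0] pos[OF that] c_eq by (simp add: node_0)
        then show ?thesis using xy(1) x by (auto simp: incident_edges_def)
      qed
      ultimately have "Suc k \<le> degree G c"
        unfolding degree_def using card_mono[OF fin_inc] by metis
      then show False using c(2) by simp
    qed
  qed
  have edge_cases: "\<exists>a b. a < k \<and> b < l a \<and> e = {\<phi> (node a b), \<phi> (node a (Suc b))}"
    if e: "e \<in> edges G" for e
  proof -
    have no_chord: False
      if "j < k" "i \<le> l j" "0 < i" "j' < k" "i' \<le> l j'" "j \<noteq> j' \<or> i' = 0" "2 \<le> i + i'"
        "{\<phi> (node j i), \<phi> (node j' i')} \<in> edges G" for j i j' i'
      using embedded_spider_chord_imp_cycle[OF simple emb that] acyc by blast
    have below: "\<exists>a b. a < k \<and> b < l a \<and> e = {\<phi> (node a b), \<phi> (node a (Suc b))}"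
      if "j < k" "i < l j" "0 < i" "\<phi> (node j i) \<in> e" for j i
    proof -
      obtain i0 where "i = Suc i0" using \<open>0 < i\<close> by (cases i) auto
      then show ?thesis
        using inner[of j i0 e] that e Suc_lessD by blast
    qed
    have center: "\<exists>a b. a < k \<and> b < l a \<and> e = {\<phi> (node a b), \<phi> (node a (Suc b))}"
      if "j < k" "i \<le> l j" "0 < i" "e = {\<phi> (node j i), c}" for j i
    proof (cases "i = 1")
      case True
      then have "e = {\<phi> (node j 0), \<phi> (node j (Suc 0))}" "0 < l j"
        using that c_eq by (auto simp: node_0)
      then show ?thesis using that(1) by blast
    next
      case False
      then show ?thesis
        using no_chord[of j i j 0] that e c_eq by (simp add: node_0)
    qed
    have "card e = 2" "e \<subseteq> verts G" using e simple by (auto simp: simple_graph_def)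
    then obtain x y where xy: "e = {x, y}" "x \<noteq> y" "x \<in> \<phi> ` ?V" "y \<in> \<phi> ` ?V"
      using spanning by (auto simp: card_2_iff)
    obtain j i where ji: "j < k" "i \<le> l j" "x = \<phi> (node j i)"
      using xy(3) V_cases by blast
    obtain j' i' where ji': "j' < k" "i' \<le> l j'" "y = \<phi> (node j' i')"
      using xy(4) V_cases by blast
    consider "i = 0" "i' = 0" | "i = 0" "0 < i'" | "0 < i" "i' = 0"
      | "0 < i" "0 < i'" "j \<noteq> j'" | "0 < i" "0 < i'" "j = j'" "i < i'"
      | "0 < i" "0 < i'" "j = j'" "i' < i" | "i = i'" "j = j'"
      by (metis gr0I linorder_neqE_nat)
    then show ?thesis
    proof cases
      case 1
      then show ?thesis using xy ji ji' by (simp add: node_0)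
    next
      case 2
      then show ?thesis
        using center[of j' i'] ji ji' xy c_eq by (simp add: node_0 insert_commute)
    next
      case 3
      then show ?thesis
        using center[of j i] ji ji' xy c_eq by (simp add: node_0)
    next
      case 4
      then show ?thesis
        using no_chord[of j i j' i'] ji ji' xy e by simp
    next
      case 5
      then show ?thesis using below[of j i] ji ji' xy by simp
    next
      case 6
      then show ?thesis using below[of j' i'] ji ji' xy by simp
    next
      case 7
      then show ?thesis using ji ji' xy by simp
    qed
  qed
  have "edges G = (\<lambda>e. \<phi> ` e) ` edges (spider_graph k l)"
  proof (intro equalityI subsetI)
    fix e assume "e \<in> edges G"
    then obtain a b where ab: "a < k" "b < l a" "e = \<phi> ` {node a b, node a (Suc b)}"
      using edge_cases by fastforce
    then have "{node a b, node a (Suc b)} \<in> edges (spider_graph k l)"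
      by (auto simp: spider_graph_def)
    then show "e \<in> (\<lambda>e. \<phi> ` e) ` edges (spider_graph k l)" using ab(3) by blast
  next
    fix e assume "e \<in> (\<lambda>e. \<phi> ` e) ` edges (spider_graph k l)"
    then show "e \<in> edges G" using adj by (auto simp: spider_graph_def)
  qed
  then have "isomorphic (spider_graph k l) G"
    unfolding isomorphic_def using inj spanning by (auto simp: bij_betw_def)
  then show ?thesis
    using that isomorphic_sym simple_spider_graph by blast
qed

theorem theorem21:
  fixes H :: "'a graph"
  assumes "simple_graph H"
    and "(\<exists>k\<ge>1. isomorphic H (path_graph k)) \<or>
         (\<exists>k\<ge>3. isomorphic H (cycle_graph k)) \<or>
         (\<exists>k\<ge>1. isomorphic H (star_graph k)) \<or>
         (\<exists>k\<le>4. H \<in> SP k)"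
  shows "interval_impropriety (K1_corona H) \<le> 2"
proof -
  \<comment> \<open>Two model graphs are provided because spiders are modelled on pairs of numbers and the other
    families on numbers.\<close>
  obtain G :: "nat graph" and G' :: "(nat \<times> nat) graph" and g h g' h' where
    "isomorphic H G \<and> corona_coloring G g h \<or> isomorphic H G' \<and> corona_coloring G' g' h'"
    using assms(2) path_corona_coloring star_corona_coloring
    by (metis cycle_corona_coloring spider_corona_coloring spider_isomorphic_spider_graph)
  then obtain g0 h0 where "corona_coloring H g0 h0"
    using corona_coloring_isomorphic[OF _ assms(1)] by metis
  then show ?thesis by (rule impropriety_le_2_if_corona_coloring)
qed

end
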